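(* For any two inner functions $\alpha$ and $\theta$, there is no conjugation $C$ on $L^2(\mathbb{T})$ such that $CM_{z^2}=M_{\bar z^2}C$ and $C(\alpha H^2)\subset\theta H^2$.
   Context: $\mathbb{T}$ is the unit circle with normalized Lebesgue measure; $H^2\subset L^2(\mathbb{T})$ is the Hardy space (functions whose negative Fourier coefficients vanish). An inner function is $\theta\in H^2\cap L^\infty(\mathbb{T})$ with $|\theta|=1$ a.e. on $\mathbb{T}$. A conjugation on a Hilbert space $\mathcal{H}$ is an antilinear map $C:\mathcal{H}\to\mathcal{H}$ with $C^2=I$ and $\langle Cf,Cg\rangle=\langle g,f\rangle$ for all $f,g$. For $\phi\in L^\infty(\mathbb{T})$, $M_\phi f=\phi f$ on $L^2(\mathbb{T})$. *)

theory Defs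
  imports "HOL-Probability.Probability"
begin

text \<open>
  The measure space underlying \<open>circle\<close> is the unit circle itself. Using Borel rather than
  Lebesgue measurable functions does not change the spaces \<open>L\<^sup>2\<close> and \<open>L\<^sup>\<infinity>\<close> of classes modulo
  almost everywhere equality.
\<close>

definition circle :: "complex measure"
  where "circle =
    distr (uniform_measure lborel {0..<2 * pi}) (restrict_space borel (sphere 0 1)) cis"

definition square_integrable :: "(complex \<Rightarrow> complex) \<Rightarrow> bool"
  where "square_integrable f \<longleftrightarrow>
    f \<in> borel_measurable circle \<and> integrable circle (\<lambda>z. (cmod (f z))\<^sup>2)"

definition essentially_bounded :: "(complex \<Rightarrow> complex) \<Rightarrow> bool"
  where "essentially_bounded f \<longleftrightarrow>
    f \<in> borel_measurable circle \<and> (\<exists>B. AE z in circle. cmod (f z) \<le> B)"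

definition L2_rel :: "(complex \<Rightarrow> complex) \<Rightarrow> (complex \<Rightarrow> complex) \<Rightarrow> bool"
  where "L2_rel f g \<longleftrightarrow>
    square_integrable f \<and> square_integrable g \<and> (AE z in circle. f z = g z)"

definition Linf_rel :: "(complex \<Rightarrow> complex) \<Rightarrow> (complex \<Rightarrow> complex) \<Rightarrow> bool"
  where "Linf_rel f g \<longleftrightarrow>
    essentially_bounded f \<and> essentially_bounded g \<and> (AE z in circle. f z = g z)"

lemma space_circle: "space circle = sphere 0 1"
  by (simp add: circle_def space_restrict_space)

lemma sets_circle: "sets circle = sets (restrict_space borel (sphere 0 1))"
  by (simp add: circle_def)

lemma cis_measurable_circle:
  "cis \<in> measurable (uniform_measure lborel {0..<2 * pi}) (restrict_space borel (sphere 0 1))"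
proof -
  have "cis \<in> borel_measurable borel"
    by (intro borel_measurable_continuous_onI continuous_intros)
  then show ?thesis
    by (intro measurable_restrict_space2) auto
qed

lemma prob_space_circle: "prob_space circle"
  unfolding circle_def
  by (intro prob_space.prob_space_distr prob_space_uniform_measure cis_measurable_circle) auto

lemma borel_measurable_circleI: "f \<in> borel_measurable borel \<Longrightarrow> f \<in> borel_measurable circle"
  by (subst measurable_cong_sets[OF sets_circle refl]) (rule measurable_restrict_space1)

lemma AE_circle_norm: "AE z in circle. cmod z = 1"
  by (rule AE_I2) (simp add: space_circle)

lemma borel_measurable_cnj_circle [measurable]:
  "f \<in> borel_measurable circle \<Longrightarrow> (\<lambda>z. cnj (f z)) \<in> borel_measurable circle"
  by (rule borel_measurable_continuous_on) (auto intro: continuous_intros)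

lemma square_integrable_0: "square_integrable (\<lambda>_. 0)"
  by (simp add: square_integrable_def)

lemma square_integrable_add:
  assumes "square_integrable f" "square_integrable g"
  shows "square_integrable (\<lambda>z. f z + g z)"
proof -
  have [measurable]: "f \<in> borel_measurable circle" "g \<in> borel_measurable circle"
    using assms by (auto simp: square_integrable_def)
  have "integrable circle (\<lambda>z. 2 * (cmod (f z))\<^sup>2 + 2 * (cmod (g z))\<^sup>2)"
    using assms by (auto simp: square_integrable_def)
  then have "integrable circle (\<lambda>z. (cmod (f z + g z))\<^sup>2)"
  proof (rule Bochner_Integration.integrable_bound)
    have "(cmod (f z + g z))\<^sup>2 \<le> 2 * (cmod (f z))\<^sup>2 + 2 * (cmod (g z))\<^sup>2" for z
    proof -
      have "(cmod (f z + g z))\<^sup>2 \<le> (cmod (f z) + cmod (g z))\<^sup>2"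
        by (intro power_mono norm_triangle_ineq) auto
      also have "\<dots> \<le> 2 * (cmod (f z))\<^sup>2 + 2 * (cmod (g z))\<^sup>2"
        using sum_squares_bound[of "cmod (f z)" "cmod (g z)"] by (simp add: power2_sum)
      finally show ?thesis .
    qed
    then show "AE z in circle. norm ((cmod (f z + g z))\<^sup>2)
        \<le> norm (2 * (cmod (f z))\<^sup>2 + 2 * (cmod (g z))\<^sup>2)"
      by simp
  qed measurable
  then show ?thesis
    by (simp add: square_integrable_def)
qed

lemma square_integrable_mult:
  assumes "essentially_bounded p" "square_integrable f"
  shows "square_integrable (\<lambda>z. p z * f z)"
proof -
  have [measurable]: "p \<in> borel_measurable circle" "f \<in> borel_measurable circle"
    using assms by (auto simp: square_integrable_def essentially_bounded_def)
  obtain B where B: "AE z in circle. cmod (p z) \<le> B"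
    using assms by (auto simp: essentially_bounded_def)
  have "integrable circle (\<lambda>z. B\<^sup>2 * (cmod (f z))\<^sup>2)"
    using assms by (auto simp: square_integrable_def)
  then have "integrable circle (\<lambda>z. (cmod (p z * f z))\<^sup>2)"
  proof (rule Bochner_Integration.integrable_bound)
    show "AE z in circle. norm ((cmod (p z * f z))\<^sup>2) \<le> norm (B\<^sup>2 * (cmod (f z))\<^sup>2)"
      using B
    proof eventually_elim
      case (elim z)
      then have "(cmod (p z))\<^sup>2 \<le> B\<^sup>2"
        by (intro power_mono) auto
      then show ?case
        by (simp add: norm_mult power_mult_distrib mult_right_mono)
    qed
  qed measurable
  then show ?thesis
    by (simp add: square_integrable_def)
qed

lemma essentially_bounded_const: "essentially_bounded (\<lambda>_. c)"
  by (auto simp: essentially_bounded_def)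

lemma essentially_bounded_cnj:
  "essentially_bounded f \<Longrightarrow> essentially_bounded (\<lambda>z. cnj (f z))"
  by (auto simp: essentially_bounded_def)

lemma essentially_bounded_power: "essentially_bounded (\<lambda>z. z ^ n)"
  unfolding essentially_bounded_def
proof
  show "(\<lambda>z. z ^ n) \<in> borel_measurable circle"
    by (intro borel_measurable_circleI) measurable
  show "\<exists>B. AE z in circle. cmod (z ^ n) \<le> B"
    using AE_circle_norm by (intro exI[of _ 1]) (auto simp: norm_power)
qed

lemma essentially_bounded_imp_square_integrable:
  assumes "essentially_bounded f"
  shows "square_integrable f"
proof -
  interpret prob_space circle by (rule prob_space_circle)
  have "square_integrable (\<lambda>_. 1)"
    by (simp add: square_integrable_def)
  from square_integrable_mult[OF assms this] show ?thesis
    by simp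
qed

quotient_type L2 = "complex \<Rightarrow> complex" / partial: L2_rel
proof (rule part_equivpI)
  show "\<exists>f. L2_rel f f"
    by (rule exI[of _ "\<lambda>_. 0"]) (simp add: L2_rel_def square_integrable_0)
  show "symp L2_rel"
    by (rule sympI) (auto simp: L2_rel_def elim: AE_mp)
  show "transp L2_rel"
    by (rule transpI) (auto simp: L2_rel_def elim: AE_mp)
qed

quotient_type Linf = "complex \<Rightarrow> complex" / partial: Linf_rel
proof (rule part_equivpI)
  show "\<exists>f. Linf_rel f f"
    by (rule exI[of _ "\<lambda>_. 0"]) (simp add: Linf_rel_def essentially_bounded_const)
  show "symp Linf_rel"
    by (rule sympI) (auto simp: Linf_rel_def elim: AE_mp)
  show "transp Linf_rel"
    by (rule transpI) (auto simp: Linf_rel_def elim: AE_mp)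
qed

instantiation L2 :: ab_group_add
begin

lift_definition zero_L2 :: L2 is "\<lambda>_. 0"
  by (simp add: L2_rel_def square_integrable_0)

lift_definition plus_L2 :: "L2 \<Rightarrow> L2 \<Rightarrow> L2" is "\<lambda>f g z. f z + g z"
  by (auto simp: L2_rel_def square_integrable_add)

lift_definition uminus_L2 :: "L2 \<Rightarrow> L2" is "\<lambda>f z. - f z"
  by (auto simp: L2_rel_def square_integrable_def)

definition minus_L2 :: "L2 \<Rightarrow> L2 \<Rightarrow> L2"
  where "minus_L2 f g = f + - g"

instance
proof
  fix f g h :: L2
  show "f + g + h = f + (g + h)"
    by transfer (auto simp: L2_rel_def square_integrable_add algebra_simps)
  show "f + g = g + f"
    by transfer (auto simp: L2_rel_def square_integrable_add algebra_simps)
  show "0 + f = f"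
    by transfer (auto simp: L2_rel_def)
  show "- f + f = 0"
    by transfer (auto simp: L2_rel_def square_integrable_0)
  show "f - g = f + - g"
    by (simp add: minus_L2_def)
qed

end

lift_definition L2_scale :: "complex \<Rightarrow> L2 \<Rightarrow> L2" is "\<lambda>c f z. c * f z"
  by (auto simp: L2_rel_def square_integrable_mult essentially_bounded_const)

lift_definition L2_inner :: "L2 \<Rightarrow> L2 \<Rightarrow> complex" is "\<lambda>f g. LINT z|circle. f z * cnj (g z)"
  by (rule integral_cong_AE) (auto simp: L2_rel_def square_integrable_def elim: AE_mp)

lift_definition fourier_coeff :: "L2 \<Rightarrow> int \<Rightarrow> complex"
  is "\<lambda>f n. LINT z|circle. f z * z powi (- n)"
proof -
  fix f g :: "complex \<Rightarrow> complex"
  assume *: "L2_rel f g"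
  have [measurable]: "(\<lambda>z. z powi (- n)) \<in> borel_measurable circle" for n
    by (intro borel_measurable_circleI) (simp add: power_int_def)
  have "(LINT z|circle. f z * z powi (- n)) = (LINT z|circle. g z * z powi (- n))" for n
    using * by (intro integral_cong_AE) (auto simp: L2_rel_def square_integrable_def elim: AE_mp)
  then show "(\<lambda>n. LINT z|circle. f z * z powi (- n)) = (\<lambda>n. LINT z|circle. g z * z powi (- n))"
    by simp
qed

definition H2 :: "L2 set"
  where "H2 = {f. \<forall>n<0. fourier_coeff f n = 0}"

lift_definition Linf_to_L2 :: "Linf \<Rightarrow> L2" is "\<lambda>f. f"
  by (simp add: L2_rel_def Linf_rel_def essentially_bounded_imp_square_integrable)

lift_definition Linf_cnj :: "Linf \<Rightarrow> Linf" is "\<lambda>f z. cnj (f z)"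
  by (auto simp: Linf_rel_def essentially_bounded_cnj)

lift_definition Linf_monom :: "nat \<Rightarrow> Linf" is "\<lambda>n z. z ^ n"
  by (simp add: Linf_rel_def essentially_bounded_power)

lift_definition Linf_unimodular :: "Linf \<Rightarrow> bool" is "\<lambda>f. AE z in circle. cmod (f z) = 1"
  by (auto simp: Linf_rel_def elim: AE_mp)

lift_definition mult_op :: "Linf \<Rightarrow> L2 \<Rightarrow> L2" is "\<lambda>p f z. p z * f z"
  by (auto simp: L2_rel_def Linf_rel_def square_integrable_mult)

definition inner_function :: "Linf \<Rightarrow> bool"
  where "inner_function \<theta> \<longleftrightarrow> Linf_to_L2 \<theta> \<in> H2 \<and> Linf_unimodular \<theta>"

definition antilinear :: "(L2 \<Rightarrow> L2) \<Rightarrow> bool"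
  where "antilinear C \<longleftrightarrow>
    (\<forall>f g. C (f + g) = C f + C g) \<and> (\<forall>c f. C (L2_scale c f) = L2_scale (cnj c) (C f))"

definition conjugation :: "(L2 \<Rightarrow> L2) \<Rightarrow> bool"
  where "conjugation C \<longleftrightarrow>
    antilinear C \<and> C \<circ> C = id \<and> (\<forall>f g. L2_inner (C f) (C g) = L2_inner g f)"

end

theory Submission imports Defs begin

text \<open>
  If \<open>f\<close> lies in \<open>\<alpha>H\<^sup>2\<close> then so does \<open>z ^ (2m) f\<close>, so its image under \<open>C\<close>, which is \<open>C f\<close>
  divided by \<open>z ^ (2m)\<close>, lies in \<open>\<theta>H\<^sup>2\<close> for every \<open>m\<close>. Writing \<open>C f = \<theta>h\<close>, all functions
  \<open>h / z ^ (2m)\<close> are in \<open>H\<^sup>2\<close>, so all Fourier coefficients of \<open>h\<close> vanish. By uniqueness of Fourier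
  coefficients \<open>C f = 0\<close>, so \<open>f = 0\<close>; but \<open>\<alpha>\<^sup>2\<close> is a nonzero element of \<open>\<alpha>H\<^sup>2\<close>.
\<close>

section \<open>Uniqueness of Fourier coefficients\<close>

lemma measurable_powi_circle [measurable]: "(\<lambda>z. z powi n) \<in> borel_measurable circle"
  by (intro borel_measurable_circleI) (simp add: power_int_def)

text \<open>The bound is asked for on the unit circle only, so that negative powers of z and
  functions continuous on the plane qualify as multipliers.\<close>

lemma integrable_mult_bounded_circle:
  fixes g k :: "complex \<Rightarrow> complex"
  assumes g: "integrable circle g" and k [measurable]: "k \<in> borel_measurable circle"
    and B: "\<And>z. cmod z = 1 \<Longrightarrow> cmod (k z) \<le> B"
  shows "integrable circle (\<lambda>z. g z * k z)"
proof -
  have [measurable]: "g \<in> borel_measurable circle"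
    using g by auto
  have "integrable circle (\<lambda>z. B * cmod (g z))"
    using g by auto
  then show ?thesis
  proof (rule Bochner_Integration.integrable_bound)
    show "AE z in circle. norm (g z * k z) \<le> norm (B * cmod (g z))"
      using AE_circle_norm
    proof eventually_elim
      case (elim z)
      have "0 \<le> B"
        using B[OF elim] norm_ge_zero order_trans by blast
      then have "cmod (g z) * cmod (k z) \<le> cmod (g z) * B"
        using B[OF elim] by (intro mult_left_mono) auto
      then show ?case
        using \<open>0 \<le> B\<close> by (simp add: norm_mult mult.commute)
    qed
  qed measurable
qed

lemma integrable_mult_powi_circle:
  "integrable circle g \<Longrightarrow> integrable circle (\<lambda>z. g z * z powi n)"
  by (rule integrable_mult_bounded_circle[where B = 1]) (auto simp: norm_power_int)

text \<open>On the circle the conjugate of z is 1/z, so a real polynomial in Re z and Im z is a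
  Laurent polynomial in z. The factor \<open>z ^ N\<close> clears the negative powers and lets the
  type of ordinary polynomials suffice.\<close>

lemma real_polynomial_function_circle_laurent:
  fixes p :: "complex \<Rightarrow> real"
  assumes "real_polynomial_function p"
  shows "\<exists>q N. \<forall>z. cmod z = 1 \<longrightarrow> complex_of_real (p z) * z ^ N = poly q z"
  using assms
proof induction
  case (linear f)
  interpret bounded_linear f by fact
  \<comment> \<open>A real-linear f satisfies f(z) = f(1) Re z + f(i) Im z = 2 Re (c z) for this c;
    multiplying by z turns the term in the conjugate of z into a constant.\<close>
  define c where "c = Complex (f 1 / 2) (- f \<i> / 2)"
  have "complex_of_real (f z) * z ^ 1 = poly [:cnj c, 0, c:] z" if z: "cmod z = 1" for z
  proof -
    have "z = Re z *\<^sub>R 1 + Im z *\<^sub>R \<i>"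
      by (simp add: complex_eq_iff)
    then have "f z = f (Re z *\<^sub>R 1 + Im z *\<^sub>R \<i>)"
      by (rule arg_cong)
    then have fz: "f z = Re z * f 1 + Im z * f \<i>"
      by (simp only: add scaleR) simp
    have "complex_of_real (f z) = c * z + cnj c * cnj z"
      by (simp add: fz c_def complex_eq_iff field_simps)
    then have "complex_of_real (f z) * z = c * z * z + cnj c * (z * cnj z)"
      by (simp add: algebra_simps)
    also have "z * cnj z = 1"
      using complex_norm_square[of z] z by simp
    finally show ?thesis
      by (simp add: algebra_simps)
  qed
  then show ?case
    by blast
next
  case (const c)
  have "complex_of_real c * z ^ 0 = poly [:complex_of_real c:] z" for z
    by simp
  then show ?case
    by blast
next
  case (add f g)
  then obtain q N r M where qr:
    "\<And>z. cmod z = 1 \<Longrightarrow> complex_of_real (f z) * z ^ N = poly q z"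
    "\<And>z. cmod z = 1 \<Longrightarrow> complex_of_real (g z) * z ^ M = poly r z"
    by blast
  \<comment> \<open>Both summands are brought to the common exponent N + M, each numerator picking
    up the monomial of the other.\<close>
  have "complex_of_real (f z + g z) * z ^ (N + M)
      = poly (q * monom 1 M + r * monom 1 N) z" if "cmod z = 1" for z
  proof -
    have "complex_of_real (f z + g z) * z ^ (N + M)
        = (complex_of_real (f z) * z ^ N) * z ^ M + (complex_of_real (g z) * z ^ M) * z ^ N"
      by (simp add: algebra_simps power_add)
    then show ?thesis
      by (simp only: qr[OF that] poly_add poly_mult poly_monom mult_1)
  qed
  then show ?case
    by blast
next
  case (mult f g)
  then obtain q N r M where qr:
    "\<And>z. cmod z = 1 \<Longrightarrow> complex_of_real (f z) * z ^ N = poly q z"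
    "\<And>z. cmod z = 1 \<Longrightarrow> complex_of_real (g z) * z ^ M = poly r z"
    by blast
  have "complex_of_real (f z * g z) * z ^ (N + M) = poly (q * r) z" if "cmod z = 1" for z
  proof -
    have "complex_of_real (f z * g z) * z ^ (N + M)
        = (complex_of_real (f z) * z ^ N) * (complex_of_real (g z) * z ^ M)"
      by (simp add: power_add mult_ac)
    then show ?thesis
      by (simp only: qr[OF that] poly_mult)
  qed
  then show ?case
    by blast
qed

section \<open>Vanishing of an integrable function with zero moments: tests against polynomials,
  continuous functions, closed sets and Borel sets\<close>

context
  fixes g :: "complex \<Rightarrow> complex"
  assumes int_g: "integrable circle g"
    and coeffs_0: "\<And>n. (LINT z|circle. g z * z powi n) = 0"
begin

lemma integral_mult_real_polynomial_0:
  assumes "real_polynomial_function p"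
  shows "(LINT z|circle. g z * complex_of_real (p z)) = 0"
proof -
  have [measurable]: "g \<in> borel_measurable circle"
    using int_g by auto
  have "p \<in> borel_measurable borel"
    using assms by (intro borel_measurable_continuous_onI continuous_at_imp_continuous_on ballI
        continuous_real_polymonial_function)
  then have [measurable]: "(\<lambda>z. complex_of_real (p z)) \<in> borel_measurable circle"
    by (intro borel_measurable_circleI) measurable
  obtain q N where q: "\<And>z. cmod z = 1 \<Longrightarrow> complex_of_real (p z) * z ^ N = poly q z"
    using real_polynomial_function_circle_laurent[OF assms] by blast
  have "(LINT z|circle. g z * complex_of_real (p z))
      = (LINT z|circle. (\<Sum>i\<le>degree q. coeff q i * (g z * z powi (int i - int N))))"
  proof (rule integral_cong_AE)
    show "AE z in circle. g z * complex_of_real (p z)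
        = (\<Sum>i\<le>degree q. coeff q i * (g z * z powi (int i - int N)))"
      using AE_circle_norm
    proof eventually_elim
      case (elim z)
      then have "z \<noteq> 0"
        by auto
      \<comment> \<open>Dividing by \<open>z ^ N\<close> yields a finite combination of integer
        powers of z, whose integrals against g all vanish.\<close>
      then have "complex_of_real (p z) = poly q z / z ^ N"
        using q[OF elim] by (simp add: field_simps)
      also have "\<dots> = (\<Sum>i\<le>degree q. coeff q i * z powi (int i - int N))"
        using \<open>z \<noteq> 0\<close> by (simp add: poly_altdef sum_divide_distrib power_int_diff)
      finally show ?case
        by (simp add: sum_distrib_left mult_ac)
    qed
  qed measurable
  also have "\<dots> = (\<Sum>i\<le>degree q. (LINT z|circle. coeff q i * (g z * z powi (int i - int N))))"
    by (intro Bochner_Integration.integral_sum integrable_mult_right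
        integrable_mult_powi_circle int_g)
  also have "\<dots> = 0"
    by (simp add: coeffs_0)
  finally show ?thesis .
qed

text \<open>By Stone-Weierstrass \<phi> is uniformly close to a polynomial on the circle, and the
  polynomial contributes nothing. The integral is therefore at most e times the L1 norm of g, for
  every e > 0.\<close>

lemma integral_mult_continuous_0:
  assumes "continuous_on UNIV \<phi>"
  shows "(LINT z|circle. g z * complex_of_real (\<phi> z)) = 0"
proof -
  have [measurable]: "g \<in> borel_measurable circle"
    using int_g by auto
  have cont_int: "integrable circle (\<lambda>z. g z * complex_of_real (\<psi> z))"
    if "continuous_on UNIV \<psi>" for \<psi> :: "complex \<Rightarrow> real"
  proof -
    have "compact (\<psi> ` sphere 0 1)"
      using that by (intro compact_continuous_image) (auto intro: continuous_on_subset)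
    then obtain B where "\<forall>x\<in>\<psi> ` sphere 0 1. norm x \<le> B"
      using compact_imp_bounded bounded_iff by metis
    then have "\<bar>\<psi> z\<bar> \<le> B" if "cmod z = 1" for z
      using that by simp
    moreover have "(\<lambda>z. complex_of_real (\<psi> z)) \<in> borel_measurable circle"
      using that by (intro borel_measurable_circleI borel_measurable_continuous_onI continuous_intros)
    ultimately show ?thesis
      by (intro integrable_mult_bounded_circle[OF int_g, where B = B]) auto
  qed
  define I where "I = (LINT z|circle. cmod (g z))"
  have "cmod (LINT z|circle. g z * complex_of_real (\<phi> z)) \<le> e * I" if e: "e > 0" for e
  proof -
    obtain p where p: "real_polynomial_function p" "\<And>z. cmod z = 1 \<Longrightarrow> \<bar>\<phi> z - p z\<bar> < e"
      using Stone_Weierstrass_real_polynomial_function[of "sphere 0 1" \<phi> e] assms e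
      by (auto intro: continuous_on_subset)
    have cp: "continuous_on UNIV p"
      using p(1) by (intro continuous_at_imp_continuous_on ballI continuous_real_polymonial_function)
    have "(LINT z|circle. g z * complex_of_real (\<phi> z))
        = (LINT z|circle. g z * complex_of_real (\<phi> z) - g z * complex_of_real (p z))"
      by (simp add: Bochner_Integration.integral_diff cont_int assms cp
          integral_mult_real_polynomial_0 p)
    also have "cmod \<dots> \<le> (LINT z|circle. e * cmod (g z))"
    proof (rule Bochner_Integration.integral_norm_bound_integral)
      show "integrable circle (\<lambda>z. g z * complex_of_real (\<phi> z) - g z * complex_of_real (p z))"
        by (intro Bochner_Integration.integrable_diff cont_int assms cp)
      show "integrable circle (\<lambda>z. e * cmod (g z))"
        using int_g by auto
      fix z assume "z \<in> space circle"
      then have "\<bar>\<phi> z - p z\<bar> \<le> e"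
        using p(2)[of z] by (simp add: space_circle)
      then have "cmod (g z) * \<bar>\<phi> z - p z\<bar> \<le> e * cmod (g z)"
        by (subst mult.commute) (auto intro: mult_right_mono)
      then show "cmod (g z * complex_of_real (\<phi> z) - g z * complex_of_real (p z)) \<le> e * cmod (g z)"
        by (simp add: norm_mult flip: right_diff_distrib of_real_diff)
    qed
    finally show ?thesis
      by (simp add: I_def)
  qed
  \<comment> \<open>The constant I does not depend on e, so e may tend to 0 from the right.\<close>
  then have "((\<lambda>e. e * I) \<longlongrightarrow> 0 * I) (at_right 0)
      \<and> eventually (\<lambda>e. cmod (LINT z|circle. g z * complex_of_real (\<phi> z)) \<le> e * I) (at_right 0)"
    by (intro conjI tendsto_intros eventually_at_rightI[of 0 1]) auto
  then have "cmod (LINT z|circle. g z * complex_of_real (\<phi> z)) \<le> 0 * I"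
    by (intro tendsto_lowerbound[of "\<lambda>e. e * I" _ "at_right 0"]) auto
  then show ?thesis
    by simp
qed

text \<open>The indicator of a closed set is a pointwise limit of continuous functions with values
  in [0, 1], so dominated convergence applies with majorant |g|.\<close>

lemma integral_mult_indicator_closed_0:
  assumes "closed A"
  shows "(LINT z|circle. g z * indicator A z) = 0"
\<comment> \<open>The empty set is treated separately because \<open>infdist z {}\<close> is 0 by
  convention, which would make the approximating functions constantly 1.\<close>
proof (cases "A = {}")
  case False
  have [measurable]: "g \<in> borel_measurable circle"
    using int_g by auto
  have [measurable]: "(\<lambda>z. indicator A z :: complex) \<in> borel_measurable circle"
    using assms by (intro borel_measurable_circleI) auto
  \<comment> \<open>For n > 0 this equals 1 on A, decreases linearly with the distance from A, and
    is 0 from distance 1/n on.\<close>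
  define \<phi> where "\<phi> n z = max 0 (1 - real n * infdist z A)" for n z
  have cont: "continuous_on UNIV (\<phi> n)" for n
    unfolding \<phi>_def by (intro continuous_intros)
  have lim: "(\<lambda>n. \<phi> n z) \<longlonglongrightarrow> indicator A z" for z
  proof (cases "z \<in> A")
    case True
    then show ?thesis
      by (simp add: \<phi>_def)
  next
    case z: False
    then have pos: "infdist z A > 0"
      using assms False by (simp add: infdist_pos_not_in_closed)
    obtain N where N: "1 < real N * infdist z A"
      using pos reals_Archimedean3 by blast
    have "\<phi> n z = 0" if "n \<ge> N" for n
    proof -
      have "real N * infdist z A \<le> real n * infdist z A"
        using that pos by (intro mult_right_mono) auto
      then show ?thesis
        using N by (simp add: \<phi>_def)
    qed
    then have "eventually (\<lambda>n. \<phi> n z = 0) sequentially"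
      by (auto simp: eventually_sequentially)
    then show ?thesis
      using z by (simp add: tendsto_eventually)
  qed
  have "(\<lambda>n. LINT z|circle. g z * complex_of_real (\<phi> n z))
      \<longlonglongrightarrow> (LINT z|circle. g z * indicator A z)"
  proof (rule integral_dominated_convergence)
    show "integrable circle (\<lambda>z. cmod (g z))"
      using int_g by auto
    show "(\<lambda>z. g z * complex_of_real (\<phi> n z)) \<in> borel_measurable circle" for n
    proof -
      have "(\<lambda>z. complex_of_real (\<phi> n z)) \<in> borel_measurable circle"
        using cont[of n] by (intro borel_measurable_circleI borel_measurable_continuous_onI continuous_intros)
      then show ?thesis
        by measurable
    qed
    have "complex_of_real (indicator A z) = indicator A z" for z
      by (simp add: indicator_def)
    then have "(\<lambda>n. g z * complex_of_real (\<phi> n z)) \<longlonglongrightarrow> g z * indicator A z" for z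
      using tendsto_mult[OF tendsto_const tendsto_of_real[OF lim, where 'a = complex]] by metis
    then show "AE z in circle. (\<lambda>n. g z * complex_of_real (\<phi> n z)) \<longlonglongrightarrow> g z * indicator A z"
      by simp
    have "\<bar>\<phi> n z\<bar> \<le> 1" for n z
      by (simp add: \<phi>_def infdist_nonneg)
    then show "AE z in circle. norm (g z * complex_of_real (\<phi> n z)) \<le> cmod (g z)" for n
      by (simp add: norm_mult mult_left_le)
  qed measurable
  then show ?thesis
    by (simp add: integral_mult_continuous_0[OF cont] LIMSEQ_const_iff)
qed simp

text \<open>Dynkin's argument: the closed sets are stable under intersection and generate the Borel
  sets, and the sets on which g integrates to 0 are closed under complements and countable disjoint
  unions.\<close>

lemma integral_mult_indicator_borel_0:
  assumes "A \<in> sets borel"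
  shows "(LINT z|circle. g z * indicator A z) = 0"
proof -
  have [measurable]: "g \<in> borel_measurable circle"
    using int_g by auto
  have ind [measurable]: "(\<lambda>z. indicator B z :: complex) \<in> borel_measurable circle"
    if "B \<in> sets borel" for B
    using that by (intro borel_measurable_circleI) auto
  have int: "integrable circle (\<lambda>z. g z * indicator B z)" if "B \<in> sets borel" for B
    using that by (intro integrable_mult_bounded_circle[OF int_g ind, where B = 1])
      (auto simp: indicator_def)
  have sb: "sets borel = sigma_sets UNIV (Collect closed :: complex set set)"
    by (simp add: borel_eq_closed)
  have "Int_stable (Collect closed :: complex set set)"
    by (auto simp: Int_stable_def)
  moreover have "Collect closed \<subseteq> Pow (UNIV :: complex set)"
    by simp
  moreover have "A \<in> sigma_sets UNIV (Collect closed)"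
    using assms sb by simp
  ultimately show ?thesis
  proof (induction rule: sigma_sets_induct_disjoint)
    case (basic B)
    then show ?case
      by (simp add: integral_mult_indicator_closed_0)
  next
    case empty
    show ?case
      by simp
  next
    case (compl B)
    then have B: "B \<in> sets borel"
      using sb by simp
    have "(LINT z|circle. g z * indicator (UNIV - B) z)
        = (LINT z|circle. g z * indicator UNIV z - g z * indicator B z)"
      by (intro Bochner_Integration.integral_cong) (auto simp: indicator_def)
    \<comment> \<open>The whole plane is closed, so the total integral of g is already known to
      vanish.\<close>
    also have "\<dots> = 0"
      using compl.IH integral_mult_indicator_closed_0[of UNIV] int[OF B] int[of UNIV]
      by (subst Bochner_Integration.integral_diff) auto
    finally show ?case .
  next
    case (union B)
    have B: "B i \<in> sets borel" for i
      using union sb by auto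
    \<comment> \<open>The countable union is the limit of its finite partial unions, and
      disjointness splits each of those into a finite sum of zero integrals.\<close>
    have "(\<lambda>n. LINT z|circle. g z * indicator (\<Union>i<n. B i) z)
        \<longlonglongrightarrow> (LINT z|circle. g z * indicator (\<Union>i. B i) z)"
    proof (rule integral_dominated_convergence)
      show "integrable circle (\<lambda>z. cmod (g z))"
        using int_g by auto
      show "AE z in circle. (\<lambda>n. g z * indicator (\<Union>i<n. B i) z)
          \<longlonglongrightarrow> g z * indicator (\<Union>i. B i) z"
        by (intro AE_I2 tendsto_mult tendsto_const LIMSEQ_indicator_UN)
      show "AE z in circle. norm (g z * indicator (\<Union>i<n. B i) z) \<le> cmod (g z)" for n
        by (auto simp: indicator_def)
    qed (use B in measurable)
    moreover have "(LINT z|circle. g z * indicator (\<Union>i<n. B i) z) = 0" for n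
    proof -
      have "indicator (\<Union>i<n. B i) z = (\<Sum>i<n. indicator (B i) z :: complex)" for z
        using \<open>disjoint_family B\<close>
        by (intro indicator_UN_disjoint) (auto intro: disjoint_family_on_mono)
      then have "(LINT z|circle. g z * indicator (\<Union>i<n. B i) z)
          = (LINT z|circle. (\<Sum>i<n. g z * indicator (B i) z))"
        by (simp add: sum_distrib_left)
      also have "\<dots> = (\<Sum>i<n. LINT z|circle. g z * indicator (B i) z)"
        by (intro Bochner_Integration.integral_sum int B)
      finally show ?thesis
        using union.IH by simp
    qed
    ultimately show ?case
      by (simp add: LIMSEQ_const_iff)
  qed
qed

lemma coeffs_0_imp_AE_0: "AE z in circle. g z = 0"
proof -
  interpret prob_space circle by (rule prob_space_circle)
  have [measurable]: "g \<in> borel_measurable circle"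
    using int_g by auto
  have 0: "(LINT z:A|circle. g z) = 0" if A: "A \<in> sets circle" for A
  proof -
    \<comment> \<open>Measurable subsets of the circle are traces of Borel subsets of the
      plane.\<close>
    obtain A' where A': "A' \<in> sets borel" "A = sphere 0 1 \<inter> A'"
      using A unfolding sets_circle sets_restrict_space by blast
    have "(LINT z:A|circle. g z) = (LINT z|circle. g z * indicator A' z)"
      unfolding set_lebesgue_integral_def
      by (intro Bochner_Integration.integral_cong)
        (auto simp: A' space_circle indicator_def)
    then show ?thesis
      using integral_mult_indicator_borel_0[OF A'(1)] by simp
  qed
  have int: "set_integrable circle A g" if "A \<in> sets circle" for A
    unfolding set_integrable_def using that int_g by (rule integrable_mult_indicator)
  \<comment> \<open>Uniqueness of densities is a statement about real functions, hence the split
    into real and imaginary parts, each compared with the density 0.\<close>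
  have "AE z in circle. Re (g z) = 0"
  proof (rule density_unique_real)
    show "(LINT z:A|circle. Re (g z)) = (LINT z:A|circle. 0)" if "A \<in> sets circle" for A
      using 0[OF that] int[OF that] integral_Re[of circle "\<lambda>z. indicator A z *\<^sub>R g z"]
      by (simp add: set_lebesgue_integral_def set_integrable_def)
  qed (use int_g in auto)
  moreover have "AE z in circle. Im (g z) = 0"
  proof (rule density_unique_real)
    show "(LINT z:A|circle. Im (g z)) = (LINT z:A|circle. 0)" if "A \<in> sets circle" for A
      using 0[OF that] int[OF that] integral_Im[of circle "\<lambda>z. indicator A z *\<^sub>R g z"]
      by (simp add: set_lebesgue_integral_def set_integrable_def)
  qed (use int_g in auto)
  ultimately show ?thesis
    by eventually_elim (simp add: complex_eq_iff)
qed

end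

text \<open>The measure is finite, so 1 + |f|^2 is integrable, and it dominates |f|.\<close>

lemma square_integrable_imp_integrable:
  assumes "square_integrable f"
  shows "integrable circle f"
proof -
  interpret prob_space circle by (rule prob_space_circle)
  have [measurable]: "f \<in> borel_measurable circle"
    using assms by (simp add: square_integrable_def)
  have "integrable circle (\<lambda>z. 1 + (cmod (f z))\<^sup>2)"
    using assms by (simp add: square_integrable_def)
  then show ?thesis
  proof (rule Bochner_Integration.integrable_bound)
    have "cmod (f z) \<le> 1 + (cmod (f z))\<^sup>2" for z
      using sum_squares_bound[of "cmod (f z)" 1] by (smt (verit) norm_ge_zero one_power2 mult_cancel_left1)
    then show "AE z in circle. norm (f z) \<le> norm (1 + (cmod (f z))\<^sup>2)"
      by simp
  qed measurable
qed

lemma fourier_coeff_eq_0_imp_eq_0: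
  assumes "\<And>n. fourier_coeff f n = 0"
  shows "f = 0"
  using assms
proof transfer
  fix f assume f: "L2_rel f f" and 0: "\<And>n. (LINT z|circle. f z * z powi - n) = 0"
  have "(LINT z|circle. f z * z powi n) = 0" for n
    using 0[of "- n"] by simp
  then have "AE z in circle. f z = 0"
    using f by (intro coeffs_0_imp_AE_0 square_integrable_imp_integrable) (simp add: L2_rel_def)
  then show "L2_rel f (\<lambda>_. 0)"
    using f by (simp add: L2_rel_def square_integrable_0)
qed

section \<open>Multiplication operators\<close>

lemma mult_op_commute: "mult_op p (mult_op q f) = mult_op q (mult_op p f)"
  by transfer (auto simp: L2_rel_def Linf_rel_def square_integrable_mult mult_ac)

lemma mult_op_0: "mult_op p 0 = 0"
  by transfer (auto simp: L2_rel_def square_integrable_0)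

text \<open>Almost everywhere the product of p with its conjugate is |p|^2 = 1. This both makes
  multiplication by \<theta> injective and inverts multiplication by a power of z.\<close>

lemma mult_op_cnj_cancel:
  assumes "Linf_unimodular p"
  shows "mult_op (Linf_cnj p) (mult_op p f) = f"
  using assms
proof transfer
  fix p f assume *: "Linf_rel p p" "L2_rel f f" "AE z in circle. cmod (p z) = 1"
  from *(3) have "AE z in circle. cnj (p z) * (p z * f z) = f z"
  proof eventually_elim
    case (elim z)
    then have "cnj (p z) * p z = 1"
      using complex_norm_square[of "p z"] by (simp add: mult.commute)
    then show ?case
      by (metis mult.assoc mult_1)
  qed
  then show "L2_rel (\<lambda>z. cnj (p z) * (p z * f z)) f"
    using * by (simp add: L2_rel_def Linf_rel_def square_integrable_mult essentially_bounded_cnj)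
qed

lemma mult_op_unimodular_inject:
  "Linf_unimodular p \<Longrightarrow> mult_op p f = mult_op p g \<longleftrightarrow> f = g"
  by (metis mult_op_cnj_cancel)

lemma unimodular_nonzero:
  assumes "Linf_unimodular p"
  shows "Linf_to_L2 p \<noteq> 0"
  using assms
proof transfer
  fix p assume *: "AE z in circle. cmod (p z) = 1"
  interpret prob_space circle by (rule prob_space_circle)
  have False if "AE z in circle. p z = 0"
  proof -
    \<comment> \<open>The values would have modulus 0 and 1 at once; a probability measure does not
      allow this almost everywhere.\<close>
    from that * have "AE z in circle. False"
      by eventually_elim simp
    then show False
      by simp
  qed
  then show "\<not> L2_rel p (\<lambda>_. 0)"
    by (auto simp: L2_rel_def)
qed

section \<open>Monomials as shifts of Fourier coefficients\<close>

lemma fourier_coeff_mult_monom: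
  "fourier_coeff (mult_op (Linf_monom k) f) n = fourier_coeff f (n - int k)"
proof transfer
  fix k f n
  assume "L2_rel f f"
  then have [measurable]: "f \<in> borel_measurable circle"
    by (simp add: L2_rel_def square_integrable_def)
  have [measurable]: "(\<lambda>z. z ^ k) \<in> borel_measurable circle"
    by (intro borel_measurable_circleI) measurable
  show "(LINT z|circle. z ^ k * f z * z powi - n) = (LINT z|circle. f z * z powi - (n - int k))"
  proof (rule integral_cong_AE)
    show "AE z in circle. z ^ k * f z * z powi - n = f z * z powi - (n - int k)"
      using AE_circle_norm
    proof eventually_elim
      case (elim z)
      then have "z \<noteq> 0"
        by auto
      then show ?case
        by (simp add: power_int_diff power_int_minus field_simps)
    qed
  qed measurable
qed

lemma unimodular_monom: "Linf_unimodular (Linf_monom k)"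
  by transfer (use AE_circle_norm in eventually_elim, simp add: norm_power)

text \<open>Multiplication by the conjugate monomial is undone by multiplication by the monomial, so
  the forward shift formula, read at index n + k, gives the backward one.\<close>

lemma fourier_coeff_mult_cnj_monom:
  "fourier_coeff (mult_op (Linf_cnj (Linf_monom k)) f) n = fourier_coeff f (n + int k)"
  using fourier_coeff_mult_monom[of k "mult_op (Linf_cnj (Linf_monom k)) f" "n + int k"]
  by (simp add: mult_op_commute[of "Linf_monom k"] mult_op_cnj_cancel unimodular_monom)

lemma mult_monom_H2: "f \<in> H2 \<Longrightarrow> mult_op (Linf_monom k) f \<in> H2"
  by (simp add: H2_def fourier_coeff_mult_monom)

lemma fourier_coeff_funpow_mult_cnj_monom:
  "fourier_coeff ((mult_op (Linf_cnj (Linf_monom k)) ^^ m) f) n = fourier_coeff f (n + int m * int k)"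
  by (induction m arbitrary: n) (simp_all add: fourier_coeff_mult_cnj_monom algebra_simps)

text \<open>Lets the factors \<alpha> and \<theta> be pulled out in front of iterated
  shifts.\<close>

lemma funpow_mult_op_commute: "(mult_op p ^^ m) (mult_op q f) = mult_op q ((mult_op p ^^ m) f)"
  by (induction m) (simp_all add: mult_op_commute)

theorem theorem5p7:
  fixes \<alpha> \<theta> :: Linf
  assumes "inner_function \<alpha>" and "inner_function \<theta>"
  shows "\<not> (\<exists>C :: L2 \<Rightarrow> L2. conjugation C \<and>
    C \<circ> mult_op (Linf_monom 2) = mult_op (Linf_cnj (Linf_monom 2)) \<circ> C \<and>
    C ` (mult_op \<alpha> ` H2) \<subseteq> mult_op \<theta> ` H2)"
proof
  assume "\<exists>C :: L2 \<Rightarrow> L2. conjugation C \<and>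
    C \<circ> mult_op (Linf_monom 2) = mult_op (Linf_cnj (Linf_monom 2)) \<circ> C \<and>
    C ` (mult_op \<alpha> ` H2) \<subseteq> mult_op \<theta> ` H2"
  then obtain C where C: "conjugation C"
    and inter: "C \<circ> mult_op (Linf_monom 2) = mult_op (Linf_cnj (Linf_monom 2)) \<circ> C"
    and sub: "C ` (mult_op \<alpha> ` H2) \<subseteq> mult_op \<theta> ` H2"
    by blast
  let ?S = "mult_op (Linf_monom 2)" and ?T = "mult_op (Linf_cnj (Linf_monom 2))"
  have \<alpha>: "Linf_to_L2 \<alpha> \<in> H2" "Linf_unimodular \<alpha>" and \<theta>: "Linf_unimodular \<theta>"
    using assms by (auto simp: inner_function_def)
  have CC: "C (C f) = f" for f
    using C by (simp add: conjugation_def fun_eq_iff)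
  have "C (0 + 0) = C 0 + C 0"
    using C unfolding conjugation_def antilinear_def by blast
  then have C0: "C 0 = 0"
    by simp
  have CS: "C ((?S ^^ m) f) = (?T ^^ m) (C f)" for m f
    using inter by (induction m) (simp_all add: fun_eq_iff)
  \<comment> \<open>Since \<alpha> itself lies in \<open>H2\<close>, this square lies in \<alpha>
    times \<open>H2\<close>; it is nonzero because \<alpha> is unimodular.\<close>
  define f where "f = mult_op \<alpha> (Linf_to_L2 \<alpha>)"
  have S_in: "(?S ^^ m) f \<in> mult_op \<alpha> ` H2" for m
  proof -
    have "(?S ^^ m) (Linf_to_L2 \<alpha>) \<in> H2"
      by (induction m) (simp_all add: \<alpha> mult_monom_H2)
    then show ?thesis
      by (simp add: f_def funpow_mult_op_commute)
  qed
  then have T_in: "(?T ^^ m) (C f) \<in> mult_op \<theta> ` H2" for m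
    using sub CS by (metis image_subset_iff)
  obtain h where h: "C f = mult_op \<theta> h"
    using T_in[of 0] by auto
  \<comment> \<open>The factor \<theta> commutes with the iterates, and multiplication by it is
    injective, so it can be cancelled.\<close>
  have T_h: "(?T ^^ m) h \<in> H2" for m
    using T_in[of m] \<theta> by (auto simp: h funpow_mult_op_commute mult_op_unimodular_inject)
  have "fourier_coeff h n = 0" for n
  proof -
    \<comment> \<open>Each application of \<open>?T\<close> lowers indices by 2, so coefficient n of
      h reappears at n - 2m. This is negative for the chosen m: it is -n - 2 if n \<ge> 0, and n
      itself, with m = 0, if n < 0.\<close>
    define m where "m = nat (n + 1)"
    have "n - int m * 2 < 0"
      by (simp add: m_def)
    then have "fourier_coeff ((?T ^^ m) h) (n - int m * 2) = 0"
      using T_h[of m] by (simp add: H2_def)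
    then show ?thesis
      by (simp add: fourier_coeff_funpow_mult_cnj_monom)
  qed
  then have "h = 0"
    by (rule fourier_coeff_eq_0_imp_eq_0)
  then have "C f = 0"
    using h by (simp add: mult_op_0)
  \<comment> \<open>C is an involution fixing 0, hence has trivial kernel.\<close>
  then have "f = 0"
    using CC[of f] C0 by simp
  then have "Linf_to_L2 \<alpha> = 0"
    using mult_op_unimodular_inject[OF \<alpha>(2), of _ 0] by (simp add: f_def mult_op_0)
  then show False
    using unimodular_nonzero[OF \<alpha>(2)] by contradiction
qed

end
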